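(* Let $G_1,G_2,G_k$ be generators with event sets $E_1,E_2,E_k$, let $E=E_1\cup E_2\cup E_k$, let $E_u\subseteq E$ be the set of uncontrollable events, and let $K\subseteq L(G_1\|G_2\|G_k)$ be a prefix-closed specification language. Assume that $G_1$ and $G_2$ are conditionally independent given $G_k$ and that $K$ is conditionally decomposable with respect to the event sets $(E_{1+k},E_{2+k},E_k)$. Then there exist supervisors $S_k$ (for the plant $G_k$), $S_1$ (for the plant $G_1\|(S_k/G_k)$) and $S_2$ (for the plant $G_2\|(S_k/G_k)$) satisfying the requirements $$L(S_k/G_k)\subseteq P_k(K),\qquad L(S_i/[G_i\|(S_k/G_k)])\subseteq P_{i+k}(K)\quad (i=1,2),$$ and such that $$L(S_1/[G_1\|(S_k/G_k)])\;\|\;L(S_2/[G_2\|(S_k/G_k)])\;\|\;L(S_k/G_k)=K$$ if and only if $K$ is conditionally controllable for the generators $(G_1,G_2,G_k)$ and the locally uncontrollable event sets $(E_{1+k,u},E_{2+k,u},E_{k,u})$.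
   Context: Generators. A generator is $G=(Q,E_G,f,q_0,Q_m)$ with finite state set $Q$, finite event set $E_G$, partial transition function $f:Q\times E_G\to Q$ (extended to words in the usual way), initial state $q_0$, marked states $Q_m\subseteq Q$. Its language is $L(G)=\{s\in E_G^*\mid f(q_0,s)\in Q\}$, i.e. the words on which $f(q_0,\cdot)$ is defined. A language $L$ is prefix-closed if it equals its prefix closure $\overline L$ (the set of all prefixes of its words). Notation. $E_{i+k}=E_i\cup E_k$; $E_{k,u}=E_u\cap E_k$; $E_{i+k,u}=E_u\cap E_{i+k}$. For $A\subseteq B$, the natural projection $B^*\to A^*$ is the monoid morphism erasing the symbols of $B\setminus A$ and fixing those of $A$. $P_k:E^*\to E_k^*$, $P_{i+k}:E^*\to E_{i+k}^*$, and $P^{i+k}_k:E_{i+k}^*\to E_k^*$ are natural projections. For languages $M_j\subseteq A_j^*$ the synchronous product is $\|_j M_j=\bigcap_j Q_j^{-1}(M_j)\subseteq(\bigcup_j A_j)^*$, where $Q_j:(\bigcup_l A_l)^*\to A_j^*$ is the natural projection. The synchronous product of generators satisfies $L(G\|G')=L(G)\|L(G')$. Supervisors. For a plant $G$ with event set $E_G$ and prefix-closed language $L(G)$, the uncontrollable events are $E_G\cap E_u$, and the control patterns are $\Gamma=\{\gamma\subseteq E_G\mid E_G\cap E_u\subseteq\gamma\}$. A supervisor is a map $S:L(G)\to\Gamma$. The closed-loop language $L(S/G)$ is the smallest language such that $\varepsilon\in L(S/G)$, and if $s\in L(S/G)$, $sa\in L(G)$ and $a\in S(s)$, then $sa\in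 L(S/G)$. The plant $G_i\|(S_k/G_k)$ has event set $E_{i+k}$ and language $L(G_i)\|L(S_k/G_k)$. Conditional independence. $G_1$ and $G_2$ are conditionally independent given $G_k$ if $E_r(G_1\|G_2)\cap E_r(G_1)\cap E_r(G_2)\subseteq E_r(G_k)$, where $E_r(G)$ is the set of all reachable symbols of $G$ (those occurring in words of $L(G)$). Conditional decomposability. $K$ is conditionally decomposable with respect to $(E_{1+k},E_{2+k},E_k)$ if $K=P_{1+k}(K)\|P_{2+k}(K)\|P_k(K)$. Conditional controllability. $K$ is conditionally controllable for $(G_1,G_2,G_k)$ and $(E_{1+k,u},E_{2+k,u},E_{k,u})$ if (i) $P_k(K)E_{k,u}\cap L(G_k)\subseteq P_k(K)$; (ii.a) $P_{1+k}(K)E_{1+k,u}\cap \big(L(G_1)\|P_k(K)\|P_k^{2+k}(L(G_2)\|P_k(K))\big)\subseteq P_{1+k}(K)$; (ii.b) $P_{2+k}(K)E_{2+k,u}\cap \big(L(G_2)\|P_k(K)\|P_k^{1+k}(L(G_1)\|P_k(K))\big)\subseteq P_{2+k}(K)$.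
   Formalization: The specification K is additionally assumed nonempty: for K = ∅ conditional controllability holds vacuously, but no supervisor satisfies L(S_k/G_k) ⊆ P_k(K) = ∅, since every closed-loop language contains the empty word. *)

theory Defs
  imports Main "HOL-Library.Sublist" "HOL-Library.FuncSet"
begin

section \<open>Languages over event sets\<close>

definition prefix_closure :: "'e list set \<Rightarrow> 'e list set" where
  "prefix_closure L = {u. \<exists>w\<in>L. prefix u w}"

definition prefix_closed :: "'e list set \<Rightarrow> bool" where
  "prefix_closed L \<longleftrightarrow> prefix_closure L = L"

text \<open>One function serves for the natural projections onto \<open>A\<close> from every larger event set:
  the source alphabet does not influence the result.\<close>

definition proj :: "'e set \<Rightarrow> 'e list \<Rightarrow> 'e list" where
  "proj A w = filter (\<lambda>a. a \<in> A) w"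

text \<open>The synchronous product depends on the event sets of its components and not only on their
  languages, so a component is a pair of an event set and a language over it; a plant, as seen by a
  supervisor, is given by the same data. Families are given
  as sets of such pairs, which loses nothing because the product is an intersection.\<close>

type_synonym 'e plant = "'e set \<times> 'e list set"

definition sync_events :: "'e plant set \<Rightarrow> 'e set" where
  "sync_events \<M> = (\<Union>(A, M)\<in>\<M>. A)"

definition sync :: "'e plant set \<Rightarrow> 'e list set" where
  "sync \<M> = {w \<in> lists (sync_events \<M>). \<forall>(A, M)\<in>\<M>. proj A w \<in> M}"

definition sync_plant :: "'e plant set \<Rightarrow> 'e plant" where
  "sync_plant \<M> = (sync_events \<M>, sync \<M>)"

definition append_event :: "'e list set \<Rightarrow> 'e set \<Rightarrow> 'e list set" where
  "append_event L A = {s @ [a] |s a. s \<in> L \<and> a \<in> A}"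


section \<open>Generators\<close>

record ('q, 'e) generator =
  states :: "'q set"
  events :: "'e set"
  trans_fun :: "'q \<times> 'e \<rightharpoonup> 'q"
  init :: "'q"
  marked :: "'q set"

definition wf_generator :: "('q, 'e) generator \<Rightarrow> bool" where
  "wf_generator G \<longleftrightarrow>
     finite (states G) \<and> finite (events G) \<and>
     dom (trans_fun G) \<subseteq> states G \<times> events G \<and> ran (trans_fun G) \<subseteq> states G \<and>
     init G \<in> states G \<and> marked G \<subseteq> states G"

fun run :: "('q \<times> 'e \<rightharpoonup> 'q) \<Rightarrow> 'q \<Rightarrow> 'e list \<Rightarrow> 'q option" where
  "run f q [] = Some q"
| "run f q (a # w) = Option.bind (f (q, a)) (\<lambda>q'. run f q' w)"

definition gen_lang :: "('q, 'e) generator \<Rightarrow> 'e list set" where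
  "gen_lang G = {s \<in> lists (events G). \<exists>q\<in>states G. run (trans_fun G) (init G) s = Some q}"

definition gen_plant :: "('q, 'e) generator \<Rightarrow> 'e plant" where
  "gen_plant G = (events G, gen_lang G)"

definition reachable_symbols :: "('q, 'e) generator \<Rightarrow> 'e set" where
  "reachable_symbols G = (\<Union>w\<in>gen_lang G. set w)"

text \<open>Shared events are executed jointly, all other events by the component owning them.\<close>

definition gen_prod ::
    "('p, 'e) generator \<Rightarrow> ('q, 'e) generator \<Rightarrow> ('p \<times> 'q, 'e) generator" where
  "gen_prod G H =
     \<lparr>states = states G \<times> states H,
      events = events G \<union> events H,
      trans_fun = (\<lambda>((p, q), a).
        if p \<notin> states G \<or> q \<notin> states H \<or> a \<notin> events G \<union> events H then None
        else Option.bind (if a \<in> events G then trans_fun G (p, a) else Some p)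
          (\<lambda>p'. map_option (Pair p')
             (if a \<in> events H then trans_fun H (q, a) else Some q))),
      init = (init G, init H),
      marked = marked G \<times> marked H\<rparr>"

lemma wf_gen_prod:
  assumes "wf_generator G" "wf_generator H"
  shows "wf_generator (gen_prod G H)"
  using assms unfolding wf_generator_def gen_prod_def
  by (auto simp: bind_eq_Some_conv ran_def dom_def split: if_splits) blast+

lemma run_states:
  assumes "wf_generator G" "q \<in> states G" "run (trans_fun G) q w = Some q'"
  shows "q' \<in> states G"
  using assms(2,3)
proof (induction w arbitrary: q)
  case (Cons a w)
  then obtain r where "trans_fun G (q, a) = Some r" "run (trans_fun G) r w = Some q'"
    by (auto simp: bind_eq_Some_conv)
  moreover have "r \<in> states G"
    using assms(1) \<open>trans_fun G (q, a) = Some r\<close> unfolding wf_generator_def ran_def by blast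
  ultimately show ?case using Cons.IH by blast
qed simp

lemma run_gen_prod:
  assumes G: "wf_generator G" and H: "wf_generator H"
    and "p \<in> states G" "q \<in> states H" "w \<in> lists (events G \<union> events H)"
  shows "run (trans_fun (gen_prod G H)) (p, q) w =
    Option.bind (run (trans_fun G) p (proj (events G) w))
      (\<lambda>p'. map_option (Pair p') (run (trans_fun H) q (proj (events H) w)))"
  using assms(3-)
proof (induction w arbitrary: p q)
  case Nil
  then show ?case by (simp add: proj_def)
next
  case (Cons a w)
  have stG: "p' \<in> states G" if "trans_fun G (p, a) = Some p'" for p'
    using G that unfolding wf_generator_def ran_def by blast
  have stH: "q' \<in> states H" if "trans_fun H (q, a) = Some q'" for q'
    using H that unfolding wf_generator_def ran_def by blast
  have w: "w \<in> lists (events G \<union> events H)" and a: "a \<in> events G \<or> a \<in> events H"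
    using Cons.prems by auto
  have step: "trans_fun (gen_prod G H) ((p, q), a) =
      Option.bind (if a \<in> events G then trans_fun G (p, a) else Some p)
        (\<lambda>p'. map_option (Pair p') (if a \<in> events H then trans_fun H (q, a) else Some q))"
    using a Cons.prems by (auto simp: gen_prod_def)
  note IH = Cons.IH[OF _ _ w]
  show ?case
    using a stG stH IH Cons.prems(1,2)
    by (cases "trans_fun G (p, a)"; cases "trans_fun H (q, a)";
        cases "a \<in> events G"; cases "a \<in> events H")
       (auto simp: step proj_def)
qed

lemma gen_lang_gen_prod:
  assumes "wf_generator G" "wf_generator H"
  shows "gen_lang (gen_prod G H) = sync {gen_plant G, gen_plant H}"
proof -
  have ev: "events (gen_prod G H) = events G \<union> events H"
    and st: "states (gen_prod G H) = states G \<times> states H"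
    and ini: "init (gen_prod G H) = (init G, init H)"
    by (simp_all add: gen_prod_def)
  have i: "init G \<in> states G" "init H \<in> states H"
    using assms by (auto simp: wf_generator_def)
  note rs = run_states[OF assms(1) i(1)] run_states[OF assms(2) i(2)]
  have "w \<in> gen_lang (gen_prod G H) \<longleftrightarrow> w \<in> sync {gen_plant G, gen_plant H}" for w
  proof (cases "w \<in> lists (events G \<union> events H)")
    case True
    have pr: "proj A w \<in> lists A" for A by (auto simp: proj_def)
    show ?thesis
      using run_gen_prod[OF assms i True] True rs pr
      by (cases "run (trans_fun G) (init G) (proj (events G) w)";
          cases "run (trans_fun H) (init H) (proj (events H) w)")
         (simp_all add: gen_lang_def sync_def sync_events_def gen_plant_def ev st ini del: in_lists_conv_set)
  next
    case False
    then show ?thesis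
      by (simp add: gen_lang_def sync_def sync_events_def gen_plant_def ev del: in_lists_conv_set)
  qed
  then show ?thesis by blast
qed


section \<open>Supervisors\<close>

text \<open>The values of a supervisor outside the plant language are irrelevant: they influence neither
  \<open>supervisor\<close> nor the closed loop.\<close>

definition control_patterns :: "'e set \<Rightarrow> 'e plant \<Rightarrow> 'e set set" where
  "control_patterns Eu P = {\<gamma>. \<gamma> \<subseteq> fst P \<and> fst P \<inter> Eu \<subseteq> \<gamma>}"

definition supervisor :: "'e set \<Rightarrow> 'e plant \<Rightarrow> ('e list \<Rightarrow> 'e set) \<Rightarrow> bool" where
  "supervisor Eu P S \<longleftrightarrow> S \<in> snd P \<rightarrow> control_patterns Eu P"

inductive_set closed_loop_lang :: "('e list \<Rightarrow> 'e set) \<Rightarrow> 'e plant \<Rightarrow> 'e list set"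
  for S :: "'e list \<Rightarrow> 'e set" and P :: "'e plant" where
  empty: "[] \<in> closed_loop_lang S P"
| step: "\<lbrakk>s \<in> closed_loop_lang S P; s @ [a] \<in> snd P; a \<in> S s\<rbrakk>
    \<Longrightarrow> s @ [a] \<in> closed_loop_lang S P"

definition closed_loop :: "('e list \<Rightarrow> 'e set) \<Rightarrow> 'e plant \<Rightarrow> 'e plant" where
  "closed_loop S P = (fst P, closed_loop_lang S P)"


section \<open>Conditional independence, decomposability and controllability\<close>

definition conditionally_independent ::
    "('q1, 'e) generator \<Rightarrow> ('q2, 'e) generator \<Rightarrow> ('qk, 'e) generator \<Rightarrow> bool" where
  "conditionally_independent G1 G2 Gk \<longleftrightarrow>
     reachable_symbols (gen_prod G1 G2) \<inter> reachable_symbols G1 \<inter> reachable_symbols G2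
       \<subseteq> reachable_symbols Gk"

definition conditionally_decomposable ::
    "'e set \<Rightarrow> 'e set \<Rightarrow> 'e set \<Rightarrow> 'e list set \<Rightarrow> bool" where
  "conditionally_decomposable E1k E2k Ek K \<longleftrightarrow>
     K = sync {(E1k, proj E1k ` K), (E2k, proj E2k ` K), (Ek, proj Ek ` K)}"

definition conditionally_controllable ::
    "('q1, 'e) generator \<Rightarrow> ('q2, 'e) generator \<Rightarrow> ('qk, 'e) generator \<Rightarrow>
     'e set \<Rightarrow> 'e set \<Rightarrow> 'e set \<Rightarrow> 'e list set \<Rightarrow> bool" where
  "conditionally_controllable G1 G2 Gk E1ku E2ku Eku K \<longleftrightarrow>
    (let Ek = events Gk; E1k = events G1 \<union> Ek; E2k = events G2 \<union> Ek;
         PkK = (Ek, proj Ek ` K)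
     in append_event (proj Ek ` K) Eku \<inter> gen_lang Gk \<subseteq> proj Ek ` K \<and>
        append_event (proj E1k ` K) E1ku \<inter>
          sync {gen_plant G1, PkK, (Ek, proj Ek ` sync {gen_plant G2, PkK})}
          \<subseteq> proj E1k ` K \<and>
        append_event (proj E2k ` K) E2ku \<inter>
          sync {gen_plant G2, PkK, (Ek, proj Ek ` sync {gen_plant G1, PkK})}
          \<subseteq> proj E2k ` K)"

end

theory Submission
  imports Defs
begin

text \<open>As \<open>K\<close> lies in the language of the global plant, \<open>P\<^sub>k(K)\<close> equals
  \<open>P\<^sub>k(L(G\<^sub>j) \<parallel> P\<^sub>k(K))\<close>, so the third factor in conditions (ii.a) and (ii.b) is redundant and
  conditional controllability says that each projection of \<open>K\<close> is controllable in the ordinary sense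
  with respect to its own local plant. The requirements together with the equation for \<open>K\<close> force the
  closed loops to be exactly these projections. Hence the theorem reduces to the
  theorem of Ramadge and Wonham, applied three times: a nonempty prefix-closed sublanguage of a plant
  is a closed-loop language if and only if it is controllable. Conditional decomposability recovers
  \<open>K\<close> from its projections.\<close>

lemma sync_pair_iff:
  "w \<in> sync {(A, M), (B, N)} \<longleftrightarrow> w \<in> lists (A \<union> B) \<and> proj A w \<in> M \<and> proj B w \<in> N"
  by (auto simp: sync_def sync_events_def)

text \<open>A product restricts words only through their projections. Applied to the closed loops,
  this gives the lower bounds opposite to the upper bounds in the requirements.\<close>

lemma proj_sync_triple:
  assumes "K = sync {(A, M), (B, N), (C, L)}"
  shows "proj C ` K \<subseteq> L" "proj A ` K \<subseteq> M" "proj B ` K \<subseteq> N"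
  using assms by (auto simp: sync_def)

lemma proj_in_lists: "proj A w \<in> lists A"
  by (auto simp: proj_def)

lemma proj_proj: "A \<subseteq> B \<Longrightarrow> proj A (proj B w) = proj A w"
  by (auto simp: proj_def intro!: filter_cong)

lemma prefix_closed_appendD: "prefix_closed L \<Longrightarrow> u @ v \<in> L \<Longrightarrow> u \<in> L"
  unfolding prefix_closed_def prefix_closure_def by (auto simp: prefix_def)

text \<open>Peel letters off the right end: the last letter adds at most one symbol to the
  projection, so a proper prefix of the projection is already a prefix of the projection of the
  shorter word.\<close>

lemma prefix_closed_proj_image:
  assumes "prefix_closed K"
  shows "prefix_closed (proj A ` K)"
proof -
  have "u \<in> proj A ` K" if "w \<in> K" "prefix u (proj A w)" for u w
    using that
  proof (induction w rule: rev_induct)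
    case Nil
    then show ?case by (force simp: proj_def)
  next
    case (snoc a w)
    have w: "w \<in> K" using prefix_closed_appendD[OF assms] snoc.prems(1) .
    show ?case
    proof (cases "u = proj A (w @ [a])")
      case True
      with snoc.prems(1) show ?thesis by blast
    next
      case False
      with snoc.prems(2) have "prefix u (proj A w)"
        by (auto simp: proj_def split: if_splits)
      with w show ?thesis by (rule snoc.IH)
    qed
  qed
  then show ?thesis
    unfolding prefix_closed_def prefix_closure_def by blast
qed

lemma Nil_in_prefix_closed: "prefix_closed L \<Longrightarrow> L \<noteq> {} \<Longrightarrow> [] \<in> L"
  using prefix_closed_appendD[of L "[]"] by auto

text \<open>Ramadge-Wonham controllability; \<open>Eu\<close> belongs to the whole system and is
  therefore cut down to the events of the plant.\<close>

definition controllable :: "'e set \<Rightarrow> 'e plant \<Rightarrow> 'e list set \<Rightarrow> bool" where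
  "controllable Eu P M \<longleftrightarrow> append_event M (Eu \<inter> fst P) \<inter> snd P \<subseteq> M"

lemma supervisor_of_controllable:
  assumes "prefix_closed M" "M \<noteq> {}" "M \<subseteq> snd P" "snd P \<subseteq> lists (fst P)"
    and "controllable Eu P M"
  obtains S where "supervisor Eu P S" "closed_loop_lang S P = M"
proof
  \<comment> \<open>The smallest control pattern that allows every continuation inside
    \<open>M\<close>.\<close>
  let ?S = "\<lambda>s. {a \<in> fst P. a \<in> Eu \<or> s @ [a] \<in> M}"
  show "supervisor Eu P ?S"
    by (auto simp: supervisor_def control_patterns_def)
  have "s \<in> M" if "s \<in> closed_loop_lang ?S P" for s
    using that
  proof induction
    case empty
    show ?case using assms(1,2) by (rule Nil_in_prefix_closed)
  next
    case (step s a)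
    \<comment> \<open>An enabled event either continues inside \<open>M\<close> or is
      uncontrollable; in the second case controllability applies.\<close>
    then show ?case
      using assms(5) by (auto simp: controllable_def append_event_def)
  qed
  moreover have "s \<in> closed_loop_lang ?S P" if "s \<in> M" for s
    using that
  proof (induction s rule: rev_induct)
    case Nil
    show ?case by (rule closed_loop_lang.empty)
  next
    case (snoc a s)
    then have "s @ [a] \<in> snd P" "a \<in> fst P"
      using assms(3,4) by auto
    with snoc show ?case
      by (auto intro: closed_loop_lang.step prefix_closed_appendD[OF assms(1)])
  qed
  ultimately show "closed_loop_lang ?S P = M" by blast
qed

text \<open>Every control pattern contains the uncontrollable events of the plant, so no supervisor
  can block one that the plant is able to execute.\<close>

lemma controllable_closed_loop_lang:
  assumes "supervisor Eu P S" "[] \<in> snd P"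
  shows "controllable Eu P (closed_loop_lang S P)"
proof -
  have "s @ [a] \<in> closed_loop_lang S P"
    if s: "s \<in> closed_loop_lang S P" and a: "a \<in> Eu \<inter> fst P" and sa: "s @ [a] \<in> snd P" for s a
  proof -
    \<comment> \<open>\<open>S\<close> is known to yield control patterns only on plant words. The
      empty word is in the closed loop unconditionally, which is why \<open>[] \<in> snd P\<close>
      is assumed.\<close>
    have "s \<in> snd P"
      using s assms(2) by cases auto
    then have "a \<in> S s"
      using assms(1) a by (auto simp: supervisor_def control_patterns_def)
    with s sa show ?thesis by (rule closed_loop_lang.step)
  qed
  then show ?thesis by (auto simp: controllable_def append_event_def)
qed

lemma proj_global_plant:
  assumes "wf_generator G1" "wf_generator G2" "wf_generator Gk"
    and "w \<in> gen_lang (gen_prod (gen_prod G1 G2) Gk)"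
  shows "proj (events G1) w \<in> gen_lang G1" "proj (events G2) w \<in> gen_lang G2"
    "proj (events Gk) w \<in> gen_lang Gk"
proof -
  have "w \<in> sync {gen_plant (gen_prod G1 G2), gen_plant Gk}"
    using assms gen_lang_gen_prod[OF wf_gen_prod] by blast
  moreover have "events (gen_prod G1 G2) = events G1 \<union> events G2"
    by (simp add: gen_prod_def)
  ultimately show "proj (events G1) w \<in> gen_lang G1" "proj (events G2) w \<in> gen_lang G2"
    "proj (events Gk) w \<in> gen_lang Gk"
    using gen_lang_gen_prod[OF assms(1,2)]
    by (auto simp: gen_plant_def sync_pair_iff proj_proj)
qed

text \<open>Both component alphabets lie in \<open>events G \<union> Ek\<close>, so projecting there
  first hides nothing from the components.\<close>

lemma proj_subset_local_plant:
  assumes "\<And>w. w \<in> K \<Longrightarrow> proj (events G) w \<in> gen_lang G"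
  shows "proj (events G \<union> Ek) ` K \<subseteq> sync {gen_plant G, (Ek, proj Ek ` K)}"
  using assms proj_in_lists[of "events G \<union> Ek"]
  by (auto simp: gen_plant_def sync_pair_iff proj_proj)

text \<open>One inclusion is imposed by the second component. For the other, projection to
  \<open>Ek\<close> factors through \<open>events G \<union> Ek\<close>, where
  \<open>proj_subset_local_plant\<close> applies.\<close>

lemma proj_local_plant:
  assumes "\<And>w. w \<in> K \<Longrightarrow> proj (events G) w \<in> gen_lang G"
  shows "proj Ek ` sync {gen_plant G, (Ek, proj Ek ` K)} = proj Ek ` K"
proof
  have "proj Ek w \<in> proj Ek ` sync {gen_plant G, (Ek, proj Ek ` K)}" if "w \<in> K" for w
    using proj_subset_local_plant[where G = G and Ek = Ek, OF assms] that
      proj_proj[of Ek "events G \<union> Ek" w]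
    by (metis (no_types, lifting) image_eqI image_subset_iff sup_ge2)
  then show "proj Ek ` K \<subseteq> proj Ek ` sync {gen_plant G, (Ek, proj Ek ` K)}" by blast
qed (auto simp: gen_plant_def sync_pair_iff)

text \<open>By \<open>proj_local_plant\<close> the third component in (ii.a) and (ii.b) equals the
  second; since components form a set, the product collapses to the local plant.\<close>

lemma conditionally_controllable_iff:
  assumes "\<And>w. w \<in> K \<Longrightarrow> proj (events G1) w \<in> gen_lang G1"
    and "\<And>w. w \<in> K \<Longrightarrow> proj (events G2) w \<in> gen_lang G2"
  shows "conditionally_controllable G1 G2 Gk
      (Eu \<inter> (events G1 \<union> events Gk)) (Eu \<inter> (events G2 \<union> events Gk)) (Eu \<inter> events Gk) K \<longleftrightarrow>
    controllable Eu (gen_plant Gk) (proj (events Gk) ` K) \<and>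
    controllable Eu (sync_plant {gen_plant G1, (events Gk, proj (events Gk) ` K)})
      (proj (events G1 \<union> events Gk) ` K) \<and>
    controllable Eu (sync_plant {gen_plant G2, (events Gk, proj (events Gk) ` K)})
      (proj (events G2 \<union> events Gk) ` K)"
  by (simp add: conditionally_controllable_def controllable_def Let_def proj_local_plant assms)
    (simp add: sync_plant_def sync_events_def gen_plant_def)

theorem theorem11:
  fixes G1 :: "('q1, 'e) generator" and G2 :: "('q2, 'e) generator"
    and Gk :: "('qk, 'e) generator"
    and E1 E2 Ek Eu :: "'e set" and K :: "'e list set"
  assumes "wf_generator G1" and "wf_generator G2" and "wf_generator Gk"
    and "events G1 = E1" and "events G2 = E2" and "events Gk = Ek"
    and "Eu \<subseteq> E1 \<union> E2 \<union> Ek"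
    and "K \<subseteq> gen_lang (gen_prod (gen_prod G1 G2) Gk)"
    and "prefix_closed K" and "K \<noteq> {}"
    and "conditionally_independent G1 G2 Gk"
    and "conditionally_decomposable (E1 \<union> Ek) (E2 \<union> Ek) Ek K"
  shows "(\<exists>Sk S1 S2.
      supervisor Eu (gen_plant Gk) Sk \<and>
      supervisor Eu (sync_plant {gen_plant G1, closed_loop Sk (gen_plant Gk)}) S1 \<and>
      supervisor Eu (sync_plant {gen_plant G2, closed_loop Sk (gen_plant Gk)}) S2 \<and>
      closed_loop_lang Sk (gen_plant Gk) \<subseteq> proj Ek ` K \<and>
      closed_loop_lang S1 (sync_plant {gen_plant G1, closed_loop Sk (gen_plant Gk)})
        \<subseteq> proj (E1 \<union> Ek) ` K \<and>
      closed_loop_lang S2 (sync_plant {gen_plant G2, closed_loop Sk (gen_plant Gk)})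
        \<subseteq> proj (E2 \<union> Ek) ` K \<and>
      sync {closed_loop S1 (sync_plant {gen_plant G1, closed_loop Sk (gen_plant Gk)}),
            closed_loop S2 (sync_plant {gen_plant G2, closed_loop Sk (gen_plant Gk)}),
            closed_loop Sk (gen_plant Gk)} = K)
    \<longleftrightarrow> conditionally_controllable G1 G2 Gk
          (Eu \<inter> (E1 \<union> Ek)) (Eu \<inter> (E2 \<union> Ek)) (Eu \<inter> Ek) K"
proof -
  let ?Kk = "proj Ek ` K" and ?K1 = "proj (E1 \<union> Ek) ` K" and ?K2 = "proj (E2 \<union> Ek) ` K"
  let ?Pk = "gen_plant Gk"
  \<comment> \<open>The local plants with the coordinator loop replaced by \<open>?Kk\<close>; each
    direction shows that its coordinator loop is indeed \<open>?Kk\<close>.\<close>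
  let ?P1 = "sync_plant {gen_plant G1, (Ek, ?Kk)}" and ?P2 = "sync_plant {gen_plant G2, (Ek, ?Kk)}"
  note ev = assms(4-6)
  have pr: "proj E1 w \<in> gen_lang G1" "proj E2 w \<in> gen_lang G2" "proj Ek w \<in> gen_lang Gk"
    if "w \<in> K" for w
    using proj_global_plant[OF assms(1-3)] assms(8) that ev by blast+
  have fst_plant [simp]: "fst ?Pk = Ek" "fst ?P1 = E1 \<union> Ek" "fst ?P2 = E2 \<union> Ek"
    using ev by (auto simp: gen_plant_def sync_plant_def sync_events_def)
  have cl [simp]: "closed_loop S ?Pk = (Ek, closed_loop_lang S ?Pk)"
    "closed_loop S ?P1 = (E1 \<union> Ek, closed_loop_lang S ?P1)"
    "closed_loop S ?P2 = (E2 \<union> Ek, closed_loop_lang S ?P2)" for S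
    by (simp_all add: closed_loop_def)
  have sub: "?Kk \<subseteq> snd ?Pk" "?K1 \<subseteq> snd ?P1" "?K2 \<subseteq> snd ?P2"
    using pr proj_subset_local_plant[of K G1 Ek] proj_subset_local_plant[of K G2 Ek] ev
    by (auto simp: gen_plant_def sync_plant_def)
  have cc: "conditionally_controllable G1 G2 Gk
      (Eu \<inter> (E1 \<union> Ek)) (Eu \<inter> (E2 \<union> Ek)) (Eu \<inter> Ek) K \<longleftrightarrow>
    controllable Eu ?Pk ?Kk \<and> controllable Eu ?P1 ?K1 \<and> controllable Eu ?P2 ?K2"
    using conditionally_controllable_iff[of K G1 G2 Gk Eu] pr ev by simp
  have closed: "prefix_closed (proj A ` K)" and ne: "proj A ` K \<noteq> {}" for A
    using prefix_closed_proj_image[OF assms(9)] assms(10) by auto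
  show ?thesis
    unfolding cc
  proof (intro iffI; (elim exE conjE)?)
    fix Sk S1 S2
    let ?Q1 = "sync_plant {gen_plant G1, closed_loop Sk ?Pk}"
      and ?Q2 = "sync_plant {gen_plant G2, closed_loop Sk ?Pk}"
    assume sup: "supervisor Eu ?Pk Sk" "supervisor Eu ?Q1 S1" "supervisor Eu ?Q2 S2"
      and le: "closed_loop_lang Sk ?Pk \<subseteq> ?Kk" "closed_loop_lang S1 ?Q1 \<subseteq> ?K1"
        "closed_loop_lang S2 ?Q2 \<subseteq> ?K2"
      and K: "sync {closed_loop S1 ?Q1, closed_loop S2 ?Q2, closed_loop Sk ?Pk} = K"
    have "fst ?Q1 = E1 \<union> Ek" "fst ?Q2 = E2 \<union> Ek"
      using ev by (auto simp: closed_loop_def gen_plant_def sync_plant_def sync_events_def)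
    then have "K = sync {(E1 \<union> Ek, closed_loop_lang S1 ?Q1), (E2 \<union> Ek, closed_loop_lang S2 ?Q2),
        (Ek, closed_loop_lang Sk ?Pk)}"
      using K by (simp add: closed_loop_def)
    then have ge: "?Kk \<subseteq> closed_loop_lang Sk ?Pk" "?K1 \<subseteq> closed_loop_lang S1 ?Q1"
        "?K2 \<subseteq> closed_loop_lang S2 ?Q2"
      by (rule proj_sync_triple)+
    \<comment> \<open>The coordinator is settled first: the plants of \<open>S1\<close> and
      \<open>S2\<close> depend on \<open>Sk\<close> only through its closed loop, so they become
      \<open>?P1\<close> and \<open>?P2\<close>.\<close>
    have k: "closed_loop_lang Sk ?Pk = ?Kk"
      using le(1) ge(1) by blast
    then have Q: "?Q1 = ?P1" "?Q2 = ?P2"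
      by simp_all
    have eq: "closed_loop_lang S1 ?P1 = ?K1" "closed_loop_lang S2 ?P2 = ?K2"
      using le(2,3) ge(2,3) unfolding Q by blast+
    \<comment> \<open>Here \<open>K \<noteq> {}\<close> enters: the projections of \<open>K\<close>
      contain the empty word and lie in the plants.\<close>
    have "[] \<in> snd ?Pk" "[] \<in> snd ?P1" "[] \<in> snd ?P2"
      using sub[THEN subsetD, OF Nil_in_prefix_closed[OF closed ne]] .
    with sup show "controllable Eu ?Pk ?Kk \<and> controllable Eu ?P1 ?K1 \<and> controllable Eu ?P2 ?K2"
      using controllable_closed_loop_lang[of Eu ?Pk Sk] controllable_closed_loop_lang[of Eu ?P1 S1]
        controllable_closed_loop_lang[of Eu ?P2 S2]
      unfolding Q k eq by blast
  next
    assume c: "controllable Eu ?Pk ?Kk" "controllable Eu ?P1 ?K1" "controllable Eu ?P2 ?K2"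
    have li: "snd ?Pk \<subseteq> lists (fst ?Pk)" "snd ?P1 \<subseteq> lists (fst ?P1)" "snd ?P2 \<subseteq> lists (fst ?P2)"
      by (auto simp: gen_plant_def gen_lang_def sync_plant_def sync_def)
    obtain Sk where Sk: "supervisor Eu ?Pk Sk" "closed_loop_lang Sk ?Pk = ?Kk"
      using supervisor_of_controllable[OF closed ne sub(1) li(1) c(1)] .
    \<comment> \<open>With \<open>Sk\<close> fixed, \<open>?P1\<close> and \<open>?P2\<close> are
      the actual local plants, so \<open>S1\<close> and \<open>S2\<close> can be chosen
      independently.\<close>
    obtain S1 where S1: "supervisor Eu ?P1 S1" "closed_loop_lang S1 ?P1 = ?K1"
      using supervisor_of_controllable[OF closed ne sub(2) li(2) c(2)] .
    obtain S2 where S2: "supervisor Eu ?P2 S2" "closed_loop_lang S2 ?P2 = ?K2"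
      using supervisor_of_controllable[OF closed ne sub(3) li(3) c(3)] .
    have "sync {(E1 \<union> Ek, ?K1), (E2 \<union> Ek, ?K2), (Ek, ?Kk)} = K"
      using assms(12) by (simp add: conditionally_decomposable_def)
    with Sk S1 S2 show "\<exists>Sk S1 S2.
      supervisor Eu (gen_plant Gk) Sk \<and>
      supervisor Eu (sync_plant {gen_plant G1, closed_loop Sk (gen_plant Gk)}) S1 \<and>
      supervisor Eu (sync_plant {gen_plant G2, closed_loop Sk (gen_plant Gk)}) S2 \<and>
      closed_loop_lang Sk (gen_plant Gk) \<subseteq> proj Ek ` K \<and>
      closed_loop_lang S1 (sync_plant {gen_plant G1, closed_loop Sk (gen_plant Gk)})
        \<subseteq> proj (E1 \<union> Ek) ` K \<and>
      closed_loop_lang S2 (sync_plant {gen_plant G2, closed_loop Sk (gen_plant Gk)})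
        \<subseteq> proj (E2 \<union> Ek) ` K \<and>
      sync {closed_loop S1 (sync_plant {gen_plant G1, closed_loop Sk (gen_plant Gk)}),
            closed_loop S2 (sync_plant {gen_plant G2, closed_loop Sk (gen_plant Gk)}),
            closed_loop Sk (gen_plant Gk)} = K"
      by (intro exI[of _ Sk] exI[of _ S1] exI[of _ S2]) simp
  qed
qed

end
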